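(* Let $\Bbbk$ be any commutative ring containing a primitive $d$th root of unity $\omega$. Then over $\Bbbk$, \[ d \cdot d! \, \det\nolimits_d = \sum_{\sigma \in S_d} (-1)^{\sigma} \sum_{j=1}^d (-1)^{(d+1)j} \left( \sum_{i=1}^d \omega^{ij} x_{i,\sigma i} \right)^d . \] In particular, if also $d!$ is invertible in $\Bbbk$, then $\operatorname{rank}(\det_d) \leq d \cdot d!$.
   Context: $d$ is a positive integer, and $\det_d$ denotes the generic $d\times d$ determinant, that is, the determinant of the $d\times d$ matrix $(x_{i,j})_{1\le i,j\le d}$ whose entries are independent variables. $S_d$ is the symmetric group on $[d]=\{1,\dots,d\}$; for $\sigma\in S_d$ and $i\in[d]$, $\sigma i$ denotes the result of $\sigma$ applied to $i$, and $(-1)^\sigma$ is the sign of $\sigma$. For a homogeneous polynomial $F\in\Bbbk[y_1,\dots,y_n]$ of degree $d$, the Waring rank $\operatorname{rank}(F)=\operatorname{rank}_{\Bbbk}(F)$ is the least number $r$ of linear forms $\ell_1,\dots,\ell_r\in\Bbbk[y_1,\dots,y_n]$ such that $F=c_1\ell_1^d+\dots+c_r\ell_r^d$ for some $c_1,\dots,c_r\in\Bbbk$.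
   Formalization: A primitive dth root of unity is taken to have order exactly d and also to satisfy that the sum of ω^{kj} over 0≤j<d is 0 for 0<k<d (automatic in integral domains); with order d alone the identity fails, e.g. in Z/15 with d=2, ω=4. *)

theory Defs
  imports
    "HOL-Library.Poly_Mapping"
    "HOL-Library.Extended_Nat"
    "HOL-Combinatorics.Permutations"
    "Jordan_Normal_Form.Determinant"
begin

(* Polynomials in variables of type 'v: finitely supported maps from exponent vectors to
   coefficients, with the convolution product of Poly_Mapping. *)
type_synonym ('v, 'a) mpoly = "('v \<Rightarrow>\<^sub>0 nat) \<Rightarrow>\<^sub>0 'a"

definition Const :: "'a::zero \<Rightarrow> ('v, 'a) mpoly" where
  "Const c = Poly_Mapping.single 0 c"

definition Var :: "'v \<Rightarrow> ('v, 'a::zero_neq_one) mpoly" where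
  "Var v = Poly_Mapping.single (Poly_Mapping.single v 1) 1"

(* The indices of the library's matrices start at 0, those of the variables at 1. *)
definition generic_matrix :: "nat \<Rightarrow> (nat \<times> nat, 'a::comm_ring_1) mpoly mat" where
  "generic_matrix d = mat d d (\<lambda>(i, j). Var (Suc i, Suc j))"

definition generic_det :: "nat \<Rightarrow> (nat \<times> nat, 'a::comm_ring_1) mpoly" where
  "generic_det d = det (generic_matrix d)"

(* In a ring with zero divisors, having multiplicative order d is too weak a notion of
   primitivity: the sums over the proper powers need not vanish (4 has order 2 in Z/15, but
   1 + 4 is nonzero). The third condition requires this; it is automatic in an integral
   domain, and more generally when no w^k - 1 with 0 < k < d is a zero divisor: see the
   two lemmas below. It also holds for the image of a primitive complex d-th root of unity
   under any ring homomorphism defined on the subring it generates. *)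
definition primitive_root_of_unity :: "nat \<Rightarrow> 'a::comm_ring_1 \<Rightarrow> bool" where
  "primitive_root_of_unity d w \<longleftrightarrow>
     w ^ d = 1 \<and>
     (\<forall>k. 0 < k \<and> k < d \<longrightarrow> w ^ k \<noteq> 1) \<and>
     (\<forall>k. 0 < k \<and> k < d \<longrightarrow> (\<Sum>j<d. (w ^ k) ^ j) = 0)"

lemma primitive_root_of_unity_if_regular:
  fixes w :: "'a::comm_ring_1"
  assumes "w ^ d = 1"
    and reg: "\<And>k x. 0 < k \<Longrightarrow> k < d \<Longrightarrow> (w ^ k - 1) * x = 0 \<Longrightarrow> x = 0"
  shows "primitive_root_of_unity d w"
proof -
  have "w ^ k \<noteq> 1" if "0 < k" "k < d" for k
    using reg[OF that, of 1] by auto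
  moreover have "(\<Sum>j<d. (w ^ k) ^ j) = 0" if "0 < k" "k < d" for k
  proof -
    have "(w ^ k - 1) * (\<Sum>j<d. (w ^ k) ^ j) = (w ^ d) ^ k - 1"
      using power_diff_1_eq[of "w ^ k" d] by (simp add: mult.commute flip: power_mult)
    then show ?thesis
      using reg[OF that] assms(1) by simp
  qed
  ultimately show ?thesis
    using assms(1) by (simp add: primitive_root_of_unity_def)
qed

lemma primitive_root_of_unity_idom:
  fixes w :: "'a::idom"
  shows "primitive_root_of_unity d w \<longleftrightarrow> w ^ d = 1 \<and> (\<forall>k. 0 < k \<and> k < d \<longrightarrow> w ^ k \<noteq> 1)"
  using primitive_root_of_unity_if_regular[of w d]
  by (auto simp: primitive_root_of_unity_def)

definition linear_forms :: "'v set \<Rightarrow> ('v, 'a::comm_ring_1) mpoly set" where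
  "linear_forms V = {\<Sum>v\<in>V. Const (a v) * Var v | a. True}"

(* Waring rank of a homogeneous polynomial F of degree d in the finitely many variables V.
   The value is infinity if F is not a linear combination of d-th powers of linear forms;
   in particular if F is not homogeneous of degree d. *)
definition waring_rank :: "'v set \<Rightarrow> nat \<Rightarrow> ('v, 'a::comm_ring_1) mpoly \<Rightarrow> enat" where
  "waring_rank V d F = Inf {enat r | r. \<exists>c l. (\<forall>k<r. l k \<in> linear_forms V) \<and>
     F = (\<Sum>k<r. Const (c k) * l k ^ d)}"

end

theory Submission
  imports Defs
begin

text \<open>
  Expand each \<open>d\<close>-th power over the functions \<open>f\<close> from \<open>{1..d}\<close> to itself and sum over \<open>j\<close> and
  \<open>\<sigma>\<close> first. If \<open>f\<close> misses two values \<open>p, q\<close>, composing \<open>\<sigma>\<close> with the transposition of \<open>p\<close> and \<open>q\<close>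
  changes only the sign, so the sum over \<open>\<sigma>\<close> vanishes. If \<open>f\<close> misses exactly one value \<open>m\<close> and takes
  \<open>r\<close> twice, then \<open>f 1 + \<dots> + f d\<close> differs from \<open>1 + \<dots> + d\<close> by \<open>r - m\<close>, which is not
  divisible by \<open>d\<close>, so the sum over \<open>j\<close> vanishes. Each of the \<open>d!\<close> bijections contributes \<open>d\<close> times
  the determinant.
\<close>

section \<open>Sums of powers of a root of unity\<close>

lemma power_mod_eq:
  fixes w :: "'a::comm_ring_1"
  assumes "w ^ d = 1"
  shows "w ^ (k mod d) = w ^ k"
proof -
  have "w ^ k = w ^ (d * (k div d) + k mod d)" by simp
  also have "\<dots> = w ^ (k mod d)" using assms by (simp only: power_add power_mult) simp
  finally show ?thesis by simp
qed

text \<open>Since \<open>w ^ d = 1\<close>, the exponent \<open>k\<close> may be reduced modulo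
  \<open>d\<close>; it becomes either 0, where every summand is 1, or one of the exponents covered
  by \<open>w0\<close>.\<close>

lemma sum_powers_root:
  fixes w :: "'a::comm_ring_1"
  assumes d: "d > 0" and w: "w ^ d = 1"
    and w0: "\<And>k. 0 < k \<Longrightarrow> k < d \<Longrightarrow> (\<Sum>j<d. (w ^ k) ^ j) = 0"
  shows "(\<Sum>j<d. w ^ (k * j)) = (if d dvd k then of_nat d else 0)"
proof -
  have "(\<Sum>j<d. w ^ (k * j)) = (\<Sum>j<d. (w ^ (k mod d)) ^ j)"
    by (simp add: power_mod_eq[OF w] power_mult)
  also have "\<dots> = (if d dvd k then of_nat d else 0)"
  proof (cases "d dvd k")
    case False
    then have "0 < k mod d" by (simp add: dvd_eq_mod_eq_0)
    then show ?thesis using False w0[of "k mod d"] d by simp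
  qed simp
  finally show ?thesis .
qed

lemma sum_double:
  fixes g :: "nat \<Rightarrow> 'a::comm_monoid_add"
  shows "(\<Sum>j<2 * h. g j) = (\<Sum>m<h. g (2 * m)) + (\<Sum>m<h. g (Suc (2 * m)))"
  by (induction h) (simp_all add: algebra_simps)

lemma double_sum_upto: "2 * \<Sum>{1..d::nat} = d * (d + 1)"
  by (induction d) simp_all

text \<open>
  Only the stated sums of powers of \<open>w\<close> are known to vanish, and \<open>w ^ (d div 2) = -1\<close> may fail.
  For even \<open>d\<close>, put \<open>A = (\<Sum>m<d div 2. w ^ (2 * s * m))\<close>. The sum is \<open>(1 - w ^ s) * A\<close>, while
  \<open>(1 + w ^ s) * A\<close> is a sum of powers without signs; hence for \<open>s\<close> not divisible by \<open>d\<close> the sum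
  equals \<open>2 * A\<close>, again a sum of powers without signs.
\<close>
lemma alternating_sum_powers_root:
  fixes w :: "'a::comm_ring_1"
  assumes d: "d > 0" and w: "w ^ d = 1"
    and w0: "\<And>k. 0 < k \<Longrightarrow> k < d \<Longrightarrow> (\<Sum>j<d. (w ^ k) ^ j) = 0"
  shows "(\<Sum>j=1..d. (- 1) ^ ((d + 1) * j) * w ^ (s * j)) =
    (if s mod d = \<Sum>{1..d} mod d then of_nat d else 0)"
proof -
  note sp = sum_powers_root[OF d w w0]
  define g where "g j = (- 1) ^ ((d + 1) * j) * w ^ (s * j)" for j
  have "w ^ (s * d) = 1" using w by (metis mult.commute power_mult power_one)
  \<comment> \<open>The sign at \<open>d\<close> is 1 because \<open>(d + 1) * d\<close> is even.
    Equal end terms allow the range 1..d to be traded for 0..d-1.\<close>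
  then have gd: "g d = g 0" by (simp add: g_def)
  have "(\<Sum>j=1..d. g j) = (\<Sum>j<d. g (Suc j))"
    using sum.atLeast1_atMost_eq[of g d] by simp
  also have "\<dots> + g 0 = (\<Sum>j<d. g j) + g d"
    by (metis add.commute sum.lessThan_Suc sum.lessThan_Suc_shift)
  finally have shift: "(\<Sum>j=1..d. g j) = (\<Sum>j<d. g j)" using gd by simp
  have gauss: "2 * \<Sum>{1..d} = d * (d + 1)" by (rule double_sum_upto)
  have "(\<Sum>j<d. g j) = (if s mod d = \<Sum>{1..d} mod d then of_nat d else 0)"
  proof (cases "even d")
    case False
    \<comment> \<open>For odd \<open>d\<close> all signs are 1 and 1 + ... + d is a multiple of
      \<open>d\<close>, so the condition on \<open>s\<close> is divisibility by
      \<open>d\<close>.\<close>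
    then have g: "g j = w ^ (s * j)" for j by (simp add: g_def)
    from False obtain e where "d + 1 = 2 * e" by (metis even_plus_one_iff evenE)
    then have "\<Sum>{1..d} = d * e" using gauss by simp
    then show ?thesis by (simp add: g sp dvd_eq_mod_eq_0)
  next
    case True
    then obtain h where h: "d = 2 * h" by (elim evenE)
    \<comment> \<open>For even \<open>d\<close> the residue singled out is \<open>h\<close>, half of
      \<open>d\<close>: the alternating sign acts like a shift of \<open>s\<close> by
      \<open>h\<close>.\<close>
    then have "\<Sum>{1..d} = h + d * h" using gauss by (simp add: algebra_simps)
    then have S: "\<Sum>{1..d} mod d = h" using h d by simp
    have g: "g j = (- 1) ^ j * w ^ (s * j)" for j
      unfolding g_def power_mult using True by simp
    define A where "A = (\<Sum>m<h. w ^ (2 * s * m))"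
    have gA: "(\<Sum>j<d. g j) = (1 - w ^ s) * A"
      unfolding h sum_double
      by (simp add: g A_def algebra_simps sum_distrib_left power_add sum_negf sum_subtractf)
    have sA: "(\<Sum>j<d. w ^ (s * j)) = (1 + w ^ s) * A"
      unfolding h sum_double
      by (simp add: A_def algebra_simps sum_distrib_left power_add sum.distrib)
    show ?thesis
    proof (cases "d dvd s")
      case True
      then have "w ^ s = 1" using w by (auto simp: power_mult)
      moreover have "s mod d \<noteq> h" using True h d by simp
      ultimately show ?thesis using gA S by simp
    next
      case False
      then have "(1 + w ^ s) * A = 0" using sA sp[of s] by simp
      then have "(1 - w ^ s) * A = 2 * A" by (simp add: algebra_simps eq_neg_iff_add_eq_0)
      \<comment> \<open>As \<open>2 * s * h = s * d\<close>, the summand has period \<open>h\<close>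
        in \<open>j\<close>, and the range consists of two periods.\<close>
      moreover have "(\<Sum>j<d. w ^ (2 * s * j)) = 2 * A"
      proof -
        have "w ^ (2 * s * (h + m)) = w ^ (2 * s * m)" for m
        proof -
          have "w ^ (2 * s * (h + m)) = (w ^ d) ^ s * w ^ (2 * s * m)"
            by (simp add: h algebra_simps flip: power_mult power_add)
          then show ?thesis using w by simp
        qed
        then have "(\<Sum>j=h..<h + h. w ^ (2 * s * j)) = A"
          using sum.shift_bounds_nat_ivl[of "\<lambda>j. w ^ (2 * s * j)" 0 h h]
          by (simp add: A_def atLeast0LessThan add.commute)
        moreover have "(\<Sum>j=0..<h. w ^ (2 * s * j)) = A" by (simp add: A_def atLeast0LessThan)
        ultimately have "(\<Sum>j=0..<h + h. w ^ (2 * s * j)) = A + A"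
          using sum.atLeastLessThan_concat[of 0 h "h + h" "\<lambda>j. w ^ (2 * s * j)"] by simp
        then show ?thesis
          by (simp add: h atLeast0LessThan flip: mult_2)
      qed
      \<comment> \<open>Divisibility means that \<open>s\<close> is a multiple of \<open>h\<close>;
        an even multiple is excluded because \<open>d\<close> does not divide \<open>s\<close>, and
        the odd ones are congruent to \<open>h\<close>.\<close>
      moreover have "d dvd 2 * s \<longleftrightarrow> s mod d = h"
      proof
        assume "d dvd 2 * s"
        then obtain q where q: "s = h * q" using h by auto
        with False h have "odd q" by auto
        then obtain e where "q = 2 * e + 1" by (elim oddE)
        then have "s = h + d * e" using q h by (simp add: algebra_simps)
        then show "s mod d = h" using h d by simp
      next
        assume "s mod d = h"
        then have "s = h + d * (s div d)" by (metis add.commute mult_div_mod_eq)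
        then have "2 * s = d * (1 + 2 * (s div d))" using h by (simp add: algebra_simps)
        then show "d dvd 2 * s" by simp
      qed
      ultimately show ?thesis using gA S sp[of "2 * s"] by simp
    qed
  qed
  then show ?thesis using shift by (simp add: g_def)
qed

section \<open>Cancellation in the expansion and the determinant identity\<close>

text \<open>Composition with the transposition matches the odd permutations with the even ones.
  Pairing them off, instead of showing that the sum equals its own negative, avoids dividing by
  2.\<close>

lemma sum_sign_eq_0_if_transpose_invariant:
  fixes g :: "('b \<Rightarrow> 'b) \<Rightarrow> 'a::comm_ring_1"
  assumes S: "finite S" "p \<in> S" "q \<in> S" "p \<noteq> q"
    and inv: "\<And>\<sigma>. \<sigma> permutes S \<Longrightarrow> g (\<sigma> \<circ> transpose p q) = g \<sigma>"
  shows "(\<Sum>\<sigma> | \<sigma> permutes S. of_int (sign \<sigma>) * g \<sigma>) = 0"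
proof -
  let ?E = "{\<sigma>. \<sigma> permutes S \<and> evenperm \<sigma>}" and ?O = "{\<sigma>. \<sigma> permutes S \<and> \<not> evenperm \<sigma>}"
  let ?\<tau> = "transpose p q"
  have \<tau>: "?\<tau> permutes S" using S by (simp add: permutes_swap_id)
  have perm: "permutation \<sigma>" if "\<sigma> permutes S" for \<sigma>
    using S(1) that by (auto simp: permutation_permutes)
  have ev: "evenperm (\<sigma> \<circ> ?\<tau>) \<longleftrightarrow> \<not> evenperm \<sigma>" if "\<sigma> permutes S" for \<sigma>
    using S(4) by (simp add: evenperm_comp perm[OF that] perm[OF \<tau>] evenperm_swap)
  have swap: "\<sigma> \<circ> ?\<tau> permutes S" if "\<sigma> permutes S" for \<sigma>
    using permutes_compose[OF \<tau> that] .
  have fin: "finite {\<sigma>. \<sigma> permutes S}" using S(1) by (rule finite_permutations)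
  have "(\<Sum>\<sigma>\<in>?O. g \<sigma>) = (\<Sum>\<sigma>\<in>?E. g \<sigma>)"
    by (rule sum.reindex_bij_witness[where i = "\<lambda>\<sigma>. \<sigma> \<circ> ?\<tau>" and j = "\<lambda>\<sigma>. \<sigma> \<circ> ?\<tau>"])
       (use swap ev inv in \<open>auto simp: comp_assoc\<close>)
  moreover have "(\<Sum>\<sigma> | \<sigma> permutes S. of_int (sign \<sigma>) * g \<sigma>) =
      (\<Sum>\<sigma>\<in>?E. of_int (sign \<sigma>) * g \<sigma>) + (\<Sum>\<sigma>\<in>?O. of_int (sign \<sigma>) * g \<sigma>)"
    using fin by (subst sum.union_disjoint[symmetric]) (auto intro!: sum.cong)
  ultimately show ?thesis by (simp add: sign_def sum_negf)
qed

text \<open>The contribution of \<open>f\<close> to the expansion is a sum over \<open>j\<close>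
  times a sum over \<open>\<sigma>\<close>. The first alternative kills the second factor, the other
  one the first.\<close>

lemma sum_sign_prod_eq_0_or_sum_shifted:
  fixes x :: "nat \<Rightarrow> nat \<Rightarrow> 'a::comm_ring_1"
  assumes f: "f ` {1..d} \<subseteq> {1..d}" and ninj: "\<not> inj_on f {1..d}"
  shows "(\<Sum>\<sigma> | \<sigma> permutes {1..d}. of_int (sign \<sigma>) * (\<Prod>k=1..d. x (f k) (\<sigma> (f k)))) = 0 \<or>
    (\<Sum>k=1..d. f k) mod d \<noteq> \<Sum>{1..d} mod d"
proof (cases "\<exists>p q. p \<in> {1..d} - f ` {1..d} \<and> q \<in> {1..d} - f ` {1..d} \<and> p \<noteq> q")
  case True
  then obtain p q where pq: "p \<in> {1..d} - f ` {1..d}" "q \<in> {1..d} - f ` {1..d}" "p \<noteq> q" by blast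
  \<comment> \<open>Neither \<open>p\<close> nor \<open>q\<close> is a value of \<open>f\<close>, so
    the transposition does not affect the product.\<close>
  have "transpose p q (f k) = f k" if "k \<in> {1..d}" for k
    using pq that by (intro transpose_apply_other) auto
  then have "(\<Prod>k=1..d. x (f k) ((\<sigma> \<circ> transpose p q) (f k))) = (\<Prod>k=1..d. x (f k) (\<sigma> (f k)))" for \<sigma>
    by (intro prod.cong) auto
  then show ?thesis
    using pq by (intro disjI1 sum_sign_eq_0_if_transpose_invariant[of _ p q]) auto
next
  case False
  from ninj obtain a b where ab: "a \<in> {1..d}" "b \<in> {1..d}" "a \<noteq> b" "f a = f b"
    by (auto simp: inj_on_def)
  have "f ` {1..d} \<noteq> {1..d}" using ninj by (metis eq_card_imp_inj_on finite_atLeastAtMost)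
  then obtain m where m: "m \<in> {1..d}" "m \<notin> f ` {1..d}" using f by blast
  with False f have im: "f ` {1..d} = {1..d} - {m}" by blast
  \<comment> \<open>Dropping one of the two colliding arguments keeps the image, and leaves as many
    arguments as values; hence the restriction is a bijection.\<close>
  have im': "f ` ({1..d} - {a}) = {1..d} - {m}"
  proof -
    have "f a \<in> f ` ({1..d} - {a})" using ab by (intro image_eqI[of _ _ b]) auto
    then show ?thesis using ab(1) im by (metis image_insert insert_Diff insert_absorb)
  qed
  then have "inj_on f ({1..d} - {a})"
    using ab m by (intro eq_card_imp_inj_on) auto
  then have "(\<Sum>k\<in>{1..d} - {a}. f k) = \<Sum>({1..d} - {m})"
    using im' by (metis sum.reindex_cong)
  moreover have "(\<Sum>k=1..d. f k) = f a + (\<Sum>k\<in>{1..d} - {a}. f k)"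
    using ab by (simp add: sum.remove)
  moreover have "\<Sum>{1..d} = m + \<Sum>({1..d} - {m})"
    using m by (simp add: sum.remove)
  ultimately have eq: "(\<Sum>k=1..d. f k) + m = \<Sum>{1..d} + f a" by simp
  have fa: "f a \<in> {1..d}" "f a \<noteq> m" using ab(1) f m by blast+
  have "(\<Sum>k=1..d. f k) mod d \<noteq> \<Sum>{1..d} mod d"
  proof
    assume "(\<Sum>k=1..d. f k) mod d = \<Sum>{1..d} mod d"
    then have "int d dvd int (\<Sum>k=1..d. f k) - int (\<Sum>{1..d})"
      by (metis mod_eq_dvd_iff zmod_int)
    moreover have "int (\<Sum>k=1..d. f k) - int (\<Sum>{1..d}) = int (f a) - int m"
      using eq by linarith
    ultimately have "int d dvd int (f a) - int m" by simp
    \<comment> \<open>A nonzero multiple of \<open>d\<close> is at least \<open>d\<close> in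
      absolute value, whereas two elements of 1..d differ by less.\<close>
    then have "int d \<le> \<bar>int (f a) - int m\<bar>"
      using fa(2) by (intro zdvd_imp_le) auto
    then show False using fa m by auto
  qed
  then show ?thesis by simp
qed

text \<open>Source of the factor \<open>fact d\<close>: it counts the functions that survive in the
  expansion.\<close>

lemma card_inj_on_endo:
  assumes "finite S"
  shows "card {f \<in> S \<rightarrow>\<^sub>E S. inj_on f S} = fact (card S)"
  using assms by (subst card_inj_on_subset_funcset) (simp_all add: fact_prod_rev)

text \<open>Stated for arbitrary ring elements, so that the argument is free of the encoding of
  polynomials; constants and variables are substituted later.\<close>

lemma determinant_power_sum_identity:
  fixes w :: "'a::comm_ring_1" and x :: "nat \<Rightarrow> nat \<Rightarrow> 'a"
  assumes d: "d > 0" and w: "w ^ d = 1"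
    and w0: "\<And>k. 0 < k \<Longrightarrow> k < d \<Longrightarrow> (\<Sum>j<d. (w ^ k) ^ j) = 0"
  shows "(\<Sum>\<sigma> | \<sigma> permutes {1..d}. of_int (sign \<sigma>) *
      (\<Sum>j=1..d. (- 1) ^ ((d + 1) * j) * (\<Sum>i=1..d. w ^ (i * j) * x i (\<sigma> i)) ^ d)) =
    of_nat (d * fact d) * (\<Sum>\<sigma> | \<sigma> permutes {1..d}. of_int (sign \<sigma>) * (\<Prod>i=1..d. x i (\<sigma> i)))"
proof -
  let ?I = "{1..d}"
  let ?P = "{\<sigma>. \<sigma> permutes ?I}"
  let ?F = "?I \<rightarrow>\<^sub>E ?I"
  \<comment> \<open>For fixed \<open>f\<close>, the dependence on \<open>\<sigma>\<close> is
    collected in \<open>D f\<close> and the dependence on \<open>j\<close> in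
    \<open>T f\<close>.\<close>
  define D where "D f = (\<Sum>\<sigma>\<in>?P. of_int (sign \<sigma>) * (\<Prod>k\<in>?I. x (f k) (\<sigma> (f k))))" for f
  define T where "T f = (\<Sum>j\<in>?I. (- 1) ^ ((d + 1) * j) * w ^ ((\<Sum>k\<in>?I. f k) * j))" for f :: "nat \<Rightarrow> nat"
  define \<Delta> where "\<Delta> = (\<Sum>\<sigma>\<in>?P. of_int (sign \<sigma>) * (\<Prod>i\<in>?I. x i (\<sigma> i)))"
  have expand: "(\<Sum>i\<in>?I. w ^ (i * j) * x i (\<sigma> i)) ^ d =
      (\<Sum>f\<in>?F. w ^ ((\<Sum>k\<in>?I. f k) * j) * (\<Prod>k\<in>?I. x (f k) (\<sigma> (f k))))" for j \<sigma>
  proof -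
    have "(\<Sum>i\<in>?I. w ^ (i * j) * x i (\<sigma> i)) ^ d = (\<Prod>k\<in>?I. \<Sum>i\<in>?I. w ^ (i * j) * x i (\<sigma> i))"
      by simp
    also have "\<dots> = (\<Sum>f\<in>?F. \<Prod>k\<in>?I. w ^ (f k * j) * x (f k) (\<sigma> (f k)))"
      by (rule prod_sum_PiE) auto
    finally show ?thesis
      by (simp add: prod.distrib sum_distrib_right power_sum)
  qed
  have "(\<Sum>\<sigma>\<in>?P. of_int (sign \<sigma>) *
      (\<Sum>j\<in>?I. (- 1) ^ ((d + 1) * j) * (\<Sum>i\<in>?I. w ^ (i * j) * x i (\<sigma> i)) ^ d)) =
    (\<Sum>\<sigma>\<in>?P. \<Sum>j\<in>?I. \<Sum>f\<in>?F. (- 1) ^ ((d + 1) * j) * w ^ ((\<Sum>k\<in>?I. f k) * j) *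
      (of_int (sign \<sigma>) * (\<Prod>k\<in>?I. x (f k) (\<sigma> (f k)))))"
    unfolding expand sum_distrib_left by (simp only: mult_ac)
  also have "\<dots> = (\<Sum>\<sigma>\<in>?P. \<Sum>f\<in>?F. \<Sum>j\<in>?I. (- 1) ^ ((d + 1) * j) * w ^ ((\<Sum>k\<in>?I. f k) * j) *
      (of_int (sign \<sigma>) * (\<Prod>k\<in>?I. x (f k) (\<sigma> (f k)))))"
    by (intro sum.cong refl sum.swap)
  also have "\<dots> = (\<Sum>f\<in>?F. \<Sum>\<sigma>\<in>?P. T f * (of_int (sign \<sigma>) * (\<Prod>k\<in>?I. x (f k) (\<sigma> (f k)))))"
    unfolding T_def sum_distrib_right by (rule sum.swap)
  also have "\<dots> = (\<Sum>f\<in>?F. T f * D f)"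
    unfolding D_def sum_distrib_left ..
  also have "\<dots> = (\<Sum>f\<in>?F. if inj_on f ?I then of_nat d * \<Delta> else 0)"
  proof (intro sum.cong refl)
    fix f assume f: "f \<in> ?F"
    then have sub: "f ` ?I \<subseteq> ?I" by auto
    have T: "T f = (if (\<Sum>k\<in>?I. f k) mod d = \<Sum>?I mod d then of_nat d else 0)"
      unfolding T_def by (rule alternating_sum_powers_root[OF d w w0])
    show "T f * D f = (if inj_on f ?I then of_nat d * \<Delta> else 0)"
    proof (cases "inj_on f ?I")
      case True
      \<comment> \<open>A bijective \<open>f\<close> only reorders the factors of each product and
        the summands of 1 + ... + d.\<close>
      then have im: "f ` ?I = ?I" using sub by (simp add: endo_inj_surj)
      have "(\<Prod>k\<in>?I. x (f k) (\<sigma> (f k))) = (\<Prod>i\<in>?I. x i (\<sigma> i))" for \<sigma>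
        using prod.reindex[OF True, of "\<lambda>i. x i (\<sigma> i)"] im by simp
      then have "D f = \<Delta>" unfolding D_def \<Delta>_def by (simp only:)
      moreover have "(\<Sum>k\<in>?I. f k) = \<Sum>?I"
        using sum.reindex[OF True, of "\<lambda>i. i"] im by simp
      ultimately show ?thesis using T True by simp
    next
      case False
      then show ?thesis
        using sum_sign_prod_eq_0_or_sum_shifted[OF sub False, of x] T by (auto simp: D_def)
    qed
  qed
  also have "\<dots> = (\<Sum>f\<in>{f \<in> ?F. inj_on f ?I}. of_nat d * \<Delta>)"
    by (rule sum.inter_filter[symmetric]) (simp add: finite_PiE)
  also have "\<dots> = of_nat (d * fact d) * \<Delta>"
    by (simp only: sum_constant card_inj_on_endo[OF finite_atLeastAtMost]) (simp add: mult_ac)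
  finally show ?thesis unfolding \<Delta>_def .
qed

section \<open>Constant polynomials and the expansion of the generic determinant\<close>

lemma Const_1 [simp]: "Const 1 = 1"
  by (simp add: Const_def)

lemma Const_0 [simp]: "Const 0 = 0"
  by (simp add: Const_def)

lemma Const_mult: "Const (a * b) = Const a * (Const b :: ('v, 'a::comm_ring_1) mpoly)"
  by (simp add: Const_def mult_single)

lemma Const_of_nat: "Const (of_nat n :: 'a::comm_ring_1) = of_nat n"
  by (simp add: Const_def)

lemma Const_of_int: "Const (of_int n :: 'a::comm_ring_1) = of_int n"
  by (simp add: Const_def)

lemma Const_power: "Const (a ^ n) = (Const a :: ('v, 'a::comm_ring_1) mpoly) ^ n"
  by (induction n) (simp_all add: Const_mult)

lemma Const_sum: "Const (\<Sum>i\<in>I. f i) = (\<Sum>i\<in>I. Const (f i :: 'a::comm_ring_1))"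
  by (induction I rule: infinite_finite_induct) (simp_all add: Const_def single_add)

text \<open>The Leibniz formula for matrices indexed from 0, transported to 1..d by conjugating each
  permutation with \<open>Suc\<close>, which preserves its sign.\<close>

lemma generic_det_expansion:
  "(generic_det d :: (nat \<times> nat, 'a::comm_ring_1) mpoly) =
    (\<Sum>\<sigma> | \<sigma> permutes {1..d}. of_int (sign \<sigma>) * (\<Prod>i=1..d. Var (i, \<sigma> i)))"
proof -
  let ?x = "\<lambda>i j. Var (i, j) :: (nat \<times> nat, 'a) mpoly"
  let ?A = "{0..<d}"
  have bij: "bij_betw Suc ?A {1..d}"
    by (simp add: bij_betw_def image_Suc_atLeastLessThan atLeastLessThanSuc_atLeastAtMost)
  have bij': "bij_betw (\<lambda>i. i - 1) {1..d} ?A"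
    by (rule bij_betw_byWitness[where f' = Suc]) auto
  have inj: "inj_on Suc ?A" by simp
  have "(generic_det d :: (nat \<times> nat, 'a) mpoly) =
      (\<Sum>\<sigma> | \<sigma> permutes ?A. of_int (sign \<sigma>) * (\<Prod>i\<in>?A. ?x (Suc i) (Suc (\<sigma> i))))"
  proof -
    have "generic_matrix d \<in> carrier_mat d d" by (simp add: generic_matrix_def)
    moreover have "\<sigma> i < d" if "\<sigma> permutes ?A" "i < d" for \<sigma> i
      using permutes_in_image[OF that(1), of i] that(2) by simp
    ultimately show ?thesis
      unfolding generic_det_def
      by (subst det_def') (auto simp: generic_matrix_def intro!: sum.cong prod.cong)
  qed
  also have "\<dots> = (\<Sum>\<sigma> | \<sigma> permutes {1..d}. of_int (sign \<sigma>) * (\<Prod>i=1..d. ?x i (\<sigma> i)))"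
  proof (rule sum.reindex_bij_witness[where j = "map_permutation ?A Suc"
        and i = "map_permutation {1..d} (\<lambda>i. i - 1)"])
    fix \<sigma> assume "\<sigma> \<in> {\<sigma>. \<sigma> permutes ?A}"
    then have \<sigma>: "\<sigma> permutes ?A" by simp
    show "map_permutation {1..d} (\<lambda>i. i - 1) (map_permutation ?A Suc \<sigma>) = \<sigma>"
      using bij \<sigma> by (rule map_permutation_compose_inv) simp
    show "map_permutation ?A Suc \<sigma> \<in> {\<sigma>. \<sigma> permutes {1..d}}"
      using map_permutation_permutes[OF bij \<sigma>] by simp
    have "(\<Prod>i=1..d. ?x i (map_permutation ?A Suc \<sigma> i)) =
        (\<Prod>i\<in>?A. ?x (Suc i) (map_permutation ?A Suc \<sigma> (Suc i)))"
      by (rule prod.reindex_bij_betw[OF bij, symmetric])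
    also have "\<dots> = (\<Prod>i\<in>?A. ?x (Suc i) (Suc (\<sigma> i)))"
      by (intro prod.cong refl) (simp add: map_permutation_apply[OF inj])
    moreover have "sign (map_permutation ?A Suc \<sigma>) = sign \<sigma>"
      using evenperm_map_permutation[OF inj \<sigma>] by (simp add: sign_def)
    ultimately show "of_int (sign (map_permutation ?A Suc \<sigma>)) *
        (\<Prod>i=1..d. ?x i (map_permutation ?A Suc \<sigma> i)) =
        of_int (sign \<sigma>) * (\<Prod>i\<in>?A. ?x (Suc i) (Suc (\<sigma> i)))"
      by simp
  next
    fix \<sigma> assume "\<sigma> \<in> {\<sigma>. \<sigma> permutes {1..d}}"
    then have \<sigma>: "\<sigma> permutes {1..d}" by simp
    show "map_permutation ?A Suc (map_permutation {1..d} (\<lambda>i. i - 1) \<sigma>) = \<sigma>"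
      using bij' \<sigma> by (rule map_permutation_compose_inv) auto
    show "map_permutation {1..d} (\<lambda>i. i - 1) \<sigma> \<in> {\<sigma>. \<sigma> permutes ?A}"
      using map_permutation_permutes[OF bij' \<sigma>] by simp
  qed
  finally show ?thesis .
qed

section \<open>Upper bounds for the Waring rank\<close>

lemma waring_rank_le_card:
  fixes F :: "('v, 'a::comm_ring_1) mpoly"
  assumes "finite I" and l: "\<And>k. k \<in> I \<Longrightarrow> l k \<in> linear_forms V"
    and F: "F = (\<Sum>k\<in>I. Const (c k) * l k ^ d)"
  shows "waring_rank V d F \<le> enat (card I)"
proof -
  obtain h where h: "bij_betw h {0..<card I} I"
    using ex_bij_betw_nat_finite[OF assms(1)] by blast
  have "F = (\<Sum>k<card I. Const (c (h k)) * l (h k) ^ d)"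
    unfolding F using sum.reindex_bij_betw[OF h, of "\<lambda>k. Const (c k) * l k ^ d"]
    by (simp add: atLeast0LessThan)
  moreover have "\<forall>k<card I. l (h k) \<in> linear_forms V"
    using l h by (auto dest: bij_betwE)
  ultimately show ?thesis
    unfolding waring_rank_def
    by (intro Inf_lower CollectI exI[of _ "card I"] conjI exI[of _ "c \<circ> h"] exI[of _ "l \<circ> h"]) auto
qed

text \<open>Variables outside the image of \<open>v\<close> receive coefficient 0; injectivity of
  \<open>v\<close> makes the coefficient of every other variable well defined.\<close>

lemma sum_Const_Var_in_linear_forms:
  assumes "finite V" "inj_on v I" "v ` I \<subseteq> V"
  shows "(\<Sum>i\<in>I. Const (a i) * Var (v i)) \<in> (linear_forms V :: ('v, 'a::comm_ring_1) mpoly set)"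
proof -
  define b where "b u = (if u \<in> v ` I then a (inv_into I v u) else 0)" for u
  have "(\<Sum>u\<in>V. Const (b u) * Var u) = (\<Sum>u\<in>v ` I. Const (b u) * Var u :: ('v, 'a) mpoly)"
    using assms by (intro sum.mono_neutral_right) (auto simp: b_def)
  also have "\<dots> = (\<Sum>i\<in>I. Const (a i) * Var (v i))"
    using assms(2) by (subst sum.reindex) (auto simp: b_def intro!: sum.cong)
  finally show ?thesis unfolding linear_forms_def by (metis (mono_tags, lifting) mem_Collect_eq)
qed

theorem theorem1:
  fixes d :: nat and \<omega> :: "'a::comm_ring_1"
  assumes "d > 0" and "primitive_root_of_unity d \<omega>"
  shows "(of_nat (d * fact d) * generic_det d :: (nat \<times> nat, 'a) mpoly) =
      (\<Sum>\<sigma> | \<sigma> permutes {1..d}. of_int (sign \<sigma>) *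
        (\<Sum>j=1..d. (- 1) ^ ((d + 1) * j) *
          (\<Sum>i=1..d. Const (\<omega> ^ (i * j)) * Var (i, \<sigma> i)) ^ d)) \<and>
    ((of_nat (fact d) :: 'a) dvd 1 \<longrightarrow>
      waring_rank ({1..d} \<times> {1..d}) d (generic_det d :: (nat \<times> nat, 'a) mpoly)
        \<le> enat (d * fact d))"
proof -
  let ?P = "{\<sigma>. \<sigma> permutes {1..d}}"
  define w :: "(nat \<times> nat, 'a) mpoly" where "w = Const \<omega>"
  define L :: "(nat \<Rightarrow> nat) \<Rightarrow> nat \<Rightarrow> (nat \<times> nat, 'a) mpoly" where
    "L \<sigma> j = (\<Sum>i=1..d. Const (\<omega> ^ (i * j)) * Var (i, \<sigma> i))" for \<sigma> j
  \<comment> \<open>\<open>Const\<close> respects sums and powers, so the relations satisfied by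
    \<open>\<omega>\<close> pass to the polynomial ring.\<close>
  have w: "w ^ d = 1"
    using assms(2) by (simp add: w_def primitive_root_of_unity_def flip: Const_power)
  have w0: "(\<Sum>j<d. (w ^ k) ^ j) = 0" if "0 < k" "k < d" for k
    using assms(2) that
    by (simp add: w_def primitive_root_of_unity_def flip: Const_power Const_sum)
  have identity: "(of_nat (d * fact d) * generic_det d :: (nat \<times> nat, 'a) mpoly) =
      (\<Sum>\<sigma>\<in>?P. of_int (sign \<sigma>) * (\<Sum>j=1..d. (- 1) ^ ((d + 1) * j) * L \<sigma> j ^ d))"
    unfolding generic_det_expansion L_def Const_power w_def[symmetric]
    by (rule determinant_power_sum_identity[OF assms(1) w w0, symmetric])
  moreover have "waring_rank ({1..d} \<times> {1..d}) d (generic_det d :: (nat \<times> nat, 'a) mpoly)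
      \<le> enat (d * fact d)" if unit: "(of_nat (fact d) :: 'a) dvd 1"
  proof -
    \<comment> \<open>As a divisor of the unit \<open>fact d\<close>, the number \<open>d\<close> is
      itself a unit, so the whole factor \<open>d * fact d\<close> can be inverted.\<close>
    have "d dvd fact d" using assms(1) by (simp add: dvd_fact)
    then have "(of_nat d :: 'a) dvd of_nat (fact d)" by (metis dvd_def of_nat_mult)
    then have "(of_nat (d * fact d) :: 'a) dvd 1"
      using unit by (metis dvd_trans is_unit_mult_iff of_nat_mult)
    then obtain u :: 'a where u: "u * of_nat (d * fact d) = 1"
      by (metis dvd_def mult.commute)
    \<comment> \<open>The scalars absorb the inverse \<open>u\<close> and both signs, leaving one
      \<open>d\<close>-th power for each pair of a permutation and an index
      \<open>j\<close>.\<close>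
    define c :: "(nat \<Rightarrow> nat) \<Rightarrow> nat \<Rightarrow> 'a" where
      "c \<sigma> j = u * (of_int (sign \<sigma>) * of_int ((- 1) ^ ((d + 1) * j)))" for \<sigma> j
    have "Const u * of_nat (d * fact d) = (Const (u * of_nat (d * fact d)) :: (nat \<times> nat, 'a) mpoly)"
      by (simp only: Const_mult Const_of_nat)
    then have "generic_det d = Const u * (of_nat (d * fact d) * generic_det d :: (nat \<times> nat, 'a) mpoly)"
      unfolding mult.assoc[symmetric] u by simp
    also have "\<dots> = (\<Sum>\<sigma>\<in>?P. \<Sum>j=1..d. Const (c \<sigma> j) * L \<sigma> j ^ d)"
      unfolding identity c_def Const_mult Const_of_int sum_distrib_left
      by (simp add: mult.assoc)
    also have "\<dots> = (\<Sum>(\<sigma>, j)\<in>?P \<times> {1..d}. Const (c \<sigma> j) * L \<sigma> j ^ d)"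
      by (simp add: sum.cartesian_product)
    finally have F: "(generic_det d :: (nat \<times> nat, 'a) mpoly) =
        (\<Sum>k\<in>?P \<times> {1..d}. Const (case_prod c k) * case_prod L k ^ d)"
      by (simp add: case_prod_unfold)
    have lin: "case_prod L k \<in> linear_forms ({1..d} \<times> {1..d})" if "k \<in> ?P \<times> {1..d}" for k
      using that unfolding L_def
      by (auto intro!: sum_Const_Var_in_linear_forms simp: inj_on_def dest: permutes_in_image)
    have "card (?P \<times> {1..d}) = d * fact d"
      by (simp add: card_cartesian_product card_permutations)
    moreover have "finite (?P \<times> {1..d})" by (simp add: finite_permutations)
    ultimately show ?thesis using waring_rank_le_card[OF _ lin F] by simp
  qed
  ultimately show ?thesis unfolding L_def by blast
qed

end
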